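(* Let $(Y,q)$ be an asymmetric normed space. Then $(Y,q)$ has the mixed binary intersection property if and only if for any asymmetric normed space $(X,p)$ and any linear subspace $Z$ of $X$ that is both $p$-closed and $\bar p$-closed, every $(p,q)$-continuous linear operator $T:Z\to Y$ admits a norm-preserving extension to $X$, that is, there exists a $(p,q)$-continuous linear operator $S:X\to Y$ such that $S|_Z=T$ and $\|S|_{p,q}=\|T|_{p,q}$.
   Context: An asymmetric norm on a real vector space $X$ is a function $p:X\to[0,\infty)$ such that, for all $x,y\in X$ and $\alpha\ge 0$: $p(x)=p(-x)=0\iff x=0$; $p(\alpha x)=\alpha p(x)$; $p(x+y)\le p(x)+p(y)$. The pair $(X,p)$ is called an asymmetric normed space. The conjugate asymmetric norm is $\bar p(x)=p(-x)$. A linear subspace $Z$ of $X$ carries the restriction of $p$. The topology $\tau_p$ on $X$ is the one in which $V$ is a neighborhood of $x$ iff $V\supseteq\{y\in X: p(y-x)<r\}$ for some $r>0$. The topology $\tau_{\bar p}$ is defined in the same way with $\bar p$ in place of $p$. A set is $p$-closed (resp. $\bar p$-closed) if it is closed with respect to $\tau_p$ (resp. $\tau_{\bar p}$). Closed balls in $(Y,q)$: for $y\in Y$ and $r>0$, $B_q[y,r]=\{z\in Y: q(z-y)\le r\}$ and $B_{\bar q}[y,r]=\{z\in Y: q(y-z)\le r\}$. A linear operator $A:X\to Y$ between asymmetric normed spaces $(X,p)$ and $(Y,q)$ is called $(p,q)$-continuous if it is continuous from $\tau_p$ to $\tau_q$; equivalently, there is $\beta\ge0$ with $q(A(x))\le\beta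 p(x)$ for all $x\in X$. Its norm $\|A|_{p,q}$ is the smallest such $\beta$; equivalently $\|A|_{p,q}=\sup\{q(A(x)):x\in X,\ p(x)\le1\}$. The space $(Y,q)$ has the mixed binary intersection property (mixed BIP, also called Isbell-completeness) if for every family $(y_i)_{i\in I}$ of elements of $Y$ and all families $(r_i)_{i\in I}$, $(s_i)_{i\in I}$ of positive real numbers: if $B_q[y_i,r_i]\cap B_{\bar q}[y_j,s_j]\neq\emptyset$ for all $i,j\in I$, then $\bigcap_{i\in I}\big(B_q[y_i,r_i]\cap B_{\bar q}[y_i,s_i]\big)\neq\emptyset$. *)

theory Defs
  imports "HOL-Analysis.Analysis"
begin

text \<open>An asymmetric normed space is a linear subspace \<open>X\<close> of an ambient real vector space together
  with a function \<open>p\<close> of which only the values on \<open>X\<close> matter. A linear subspace \<open>Z\<close> of \<open>X\<close> with the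
  restricted asymmetric norm is then simply \<open>(Z, p)\<close>.\<close>

locale asymmetric_normed_space =
  fixes X :: "'a::real_vector set" and p :: "'a \<Rightarrow> real"
  assumes subspace: "subspace X"
    and nonneg: "x \<in> X \<Longrightarrow> 0 \<le> p x"
    and separating: "x \<in> X \<Longrightarrow> p x = 0 \<and> p (- x) = 0 \<longleftrightarrow> x = 0"
    and pos_homogeneous: "x \<in> X \<Longrightarrow> 0 \<le> \<alpha> \<Longrightarrow> p (\<alpha> *\<^sub>R x) = \<alpha> * p x"
    and triangle: "x \<in> X \<Longrightarrow> y \<in> X \<Longrightarrow> p (x + y) \<le> p x + p y"

definition conjugate :: "('a::real_vector \<Rightarrow> real) \<Rightarrow> 'a \<Rightarrow> real" where
  "conjugate p = (\<lambda>x. p (- x))"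

definition asym_ball :: "'a::real_vector set \<Rightarrow> ('a \<Rightarrow> real) \<Rightarrow> 'a \<Rightarrow> real \<Rightarrow> 'a set" where
  "asym_ball X p x r = {y \<in> X. p (y - x) < r}"

definition asym_cball :: "'a::real_vector set \<Rightarrow> ('a \<Rightarrow> real) \<Rightarrow> 'a \<Rightarrow> real \<Rightarrow> 'a set" where
  "asym_cball X p x r = {y \<in> X. p (y - x) \<le> r}"

definition asym_topology :: "'a::real_vector set \<Rightarrow> ('a \<Rightarrow> real) \<Rightarrow> 'a topology" where
  "asym_topology X p =
     topology (\<lambda>U. U \<subseteq> X \<and> (\<forall>x\<in>U. \<exists>r>0. asym_ball X p x r \<subseteq> U))"

lemma openin_asym_topology:
  "openin (asym_topology X p) U \<longleftrightarrow> U \<subseteq> X \<and> (\<forall>x\<in>U. \<exists>r>0. asym_ball X p x r \<subseteq> U)"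
proof -
  have "istopology (\<lambda>U. U \<subseteq> X \<and> (\<forall>x\<in>U. \<exists>r>0. asym_ball X p x r \<subseteq> U))"
    unfolding istopology_def
  proof (intro conjI allI impI ballI)
    fix S T x
    assume S: "S \<subseteq> X \<and> (\<forall>x\<in>S. \<exists>r>0. asym_ball X p x r \<subseteq> S)"
      and T: "T \<subseteq> X \<and> (\<forall>x\<in>T. \<exists>r>0. asym_ball X p x r \<subseteq> T)"
    show "S \<inter> T \<subseteq> X" using S by blast
    assume x: "x \<in> S \<inter> T"
    obtain r1 where r1: "r1 > 0" "asym_ball X p x r1 \<subseteq> S" using S x by blast
    obtain r2 where r2: "r2 > 0" "asym_ball X p x r2 \<subseteq> T" using T x by blast
    have "asym_ball X p x (min r1 r2) \<subseteq> S \<inter> T"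
      using r1 r2 unfolding asym_ball_def by auto
    then show "\<exists>r>0. asym_ball X p x r \<subseteq> S \<inter> T"
      using r1 r2 by (intro exI[of _ "min r1 r2"]) auto
  next
    fix K x
    assume K: "\<forall>S\<in>K. S \<subseteq> X \<and> (\<forall>x\<in>S. \<exists>r>0. asym_ball X p x r \<subseteq> S)"
    show "\<Union>K \<subseteq> X" using K by blast
    assume "x \<in> \<Union>K"
    then obtain S where "S \<in> K" "x \<in> S" by blast
    with K obtain r where "r > 0" "asym_ball X p x r \<subseteq> S" by blast
    with \<open>S \<in> K\<close> show "\<exists>r>0. asym_ball X p x r \<subseteq> \<Union>K" by blast
  qed
  then show ?thesis
    unfolding asym_topology_def by (simp add: topology_inverse')
qed

lemma (in asymmetric_normed_space) neighbourhood_asym_topology: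
  assumes "x \<in> X" and "V \<subseteq> X"
  shows "(\<exists>U. openin (asym_topology X p) U \<and> x \<in> U \<and> U \<subseteq> V) \<longleftrightarrow> (\<exists>r>0. asym_ball X p x r \<subseteq> V)"
proof
  assume "\<exists>U. openin (asym_topology X p) U \<and> x \<in> U \<and> U \<subseteq> V"
  then show "\<exists>r>0. asym_ball X p x r \<subseteq> V"
    unfolding openin_asym_topology by blast
next
  assume "\<exists>r>0. asym_ball X p x r \<subseteq> V"
  then obtain r where r: "r > 0" "asym_ball X p x r \<subseteq> V" by blast
  have "asym_ball X p y (r - p (y - x)) \<subseteq> asym_ball X p x r" if "y \<in> asym_ball X p x r" for y
  proof
    fix z assume z: "z \<in> asym_ball X p y (r - p (y - x))"
    have "p ((z - y) + (y - x)) \<le> p (z - y) + p (y - x)"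
      using z that assms(1) subspace
      by (intro triangle) (auto simp: asym_ball_def intro: subspace_diff)
    then show "z \<in> asym_ball X p x r"
      using z by (auto simp: asym_ball_def)
  qed
  moreover have "0 < r - p (y - x)" if "y \<in> asym_ball X p x r" for y
    using that by (simp add: asym_ball_def)
  ultimately have "\<exists>r'>0. asym_ball X p y r' \<subseteq> asym_ball X p x r" if "y \<in> asym_ball X p x r" for y
    using that by blast
  then have "openin (asym_topology X p) (asym_ball X p x r)"
    unfolding openin_asym_topology by (auto simp: asym_ball_def)
  moreover have "x \<in> asym_ball X p x r"
    using r assms(1) separating[of 0] subspace by (auto simp: asym_ball_def subspace_0)
  ultimately show "\<exists>U. openin (asym_topology X p) U \<and> x \<in> U \<and> U \<subseteq> V"
    using r by blast
qed

definition linear_on :: "'a::real_vector set \<Rightarrow> ('a \<Rightarrow> 'b::real_vector) \<Rightarrow> bool" where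
  "linear_on X A \<longleftrightarrow>
     (\<forall>x\<in>X. \<forall>y\<in>X. A (x + y) = A x + A y) \<and> (\<forall>c. \<forall>x\<in>X. A (c *\<^sub>R x) = c *\<^sub>R A x)"

definition continuous_linear_operator ::
    "'a::real_vector set \<Rightarrow> ('a \<Rightarrow> real) \<Rightarrow> 'b::real_vector set \<Rightarrow> ('b \<Rightarrow> real) \<Rightarrow> ('a \<Rightarrow> 'b) \<Rightarrow> bool" where
  "continuous_linear_operator X p Y q A \<longleftrightarrow>
     A \<in> X \<rightarrow> Y \<and> linear_on X A \<and> continuous_map (asym_topology X p) (asym_topology Y q) A"

definition asym_opnorm ::
    "'a::real_vector set \<Rightarrow> ('a \<Rightarrow> real) \<Rightarrow> ('b::real_vector \<Rightarrow> real) \<Rightarrow> ('a \<Rightarrow> 'b) \<Rightarrow> real" where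
  "asym_opnorm X p q A = (LEAST \<beta>. 0 \<le> \<beta> \<and> (\<forall>x\<in>X. q (A x) \<le> \<beta> * p x))"

text \<open>The property only depends on the set of triples \<open>(y i, r i, s i)\<close>, so index sets
  \<open>I :: ('b \<times> real \<times> real) set\<close> cover families over arbitrary index types; see
  \<open>mixed_BIP_any_index\<close>.\<close>

definition mixed_BIP :: "'b::real_vector set \<Rightarrow> ('b \<Rightarrow> real) \<Rightarrow> bool" where
  "mixed_BIP Y q \<longleftrightarrow>
     (\<forall>(I :: ('b \<times> real \<times> real) set) y r s.
        (\<forall>i\<in>I. y i \<in> Y \<and> 0 < r i \<and> 0 < s i) \<longrightarrow>
        (\<forall>i\<in>I. \<forall>j\<in>I.
           asym_cball Y q (y i) (r i) \<inter> asym_cball Y (conjugate q) (y j) (s j) \<noteq> {}) \<longrightarrow>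
        (\<Inter>i\<in>I. asym_cball Y q (y i) (r i) \<inter> asym_cball Y (conjugate q) (y i) (s i)) \<noteq> {})"

lemma mixed_BIP_any_index:
  fixes I :: "'i set"
  assumes "mixed_BIP Y q"
    and "\<And>i. i \<in> I \<Longrightarrow> y i \<in> Y \<and> 0 < r i \<and> 0 < s i"
    and "\<And>i j. i \<in> I \<Longrightarrow> j \<in> I \<Longrightarrow>
           asym_cball Y q (y i) (r i) \<inter> asym_cball Y (conjugate q) (y j) (s j) \<noteq> {}"
  shows "(\<Inter>i\<in>I. asym_cball Y q (y i) (r i) \<inter> asym_cball Y (conjugate q) (y i) (s i)) \<noteq> {}"
proof -
  have "(\<Inter>t\<in>(\<lambda>i. (y i, r i, s i)) ` I. asym_cball Y q (fst t) (fst (snd t)) \<inter>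
           asym_cball Y (conjugate q) (fst t) (snd (snd t))) \<noteq> {}"
    by (rule assms(1)[unfolded mixed_BIP_def, rule_format]) (use assms(2,3) in auto)
  then show ?thesis by simp
qed

text \<open>The first argument only carries the ambient type in which the spaces \<open>(X, p)\<close> live. Every real
  vector space is isomorphic to a subspace of some type of class \<open>real_vector\<close>. Quantification over all spaces thus amounts to quantification over
  the ambient type; where the property is used as a hypothesis, requiring it for a single ambient type
  is the weaker requirement.\<close>

definition norm_preserving_extension_property ::
    "'a::real_vector itself \<Rightarrow> 'b::real_vector set \<Rightarrow> ('b \<Rightarrow> real) \<Rightarrow> bool" where
  "norm_preserving_extension_property _ Y q \<longleftrightarrow>
     (\<forall>(X :: 'a set) p Z T.
        asymmetric_normed_space X p \<longrightarrow>
        subspace Z \<longrightarrow> Z \<subseteq> X \<longrightarrow>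
        closedin (asym_topology X p) Z \<longrightarrow>
        closedin (asym_topology X (conjugate p)) Z \<longrightarrow>
        continuous_linear_operator Z p Y q T \<longrightarrow>
        (\<exists>S. continuous_linear_operator X p Y q S \<and>
             (\<forall>z\<in>Z. S z = T z) \<and>
             asym_opnorm X p q S = asym_opnorm Z p q T))"

end

theory Submission
  imports Defs
begin

text \<open>
  If \<open>Y\<close> has the ball property for all nonnegative radii, extend an operator \<open>T\<close> with \<open>q (T z) \<le> \<beta> p z\<close>
  to one more vector \<open>x\<^sub>0\<close> by choosing its image in all the balls with centres \<open>T z\<close> and radii
  \<open>\<beta> p (x\<^sub>0 - z)\<close>, \<open>\<beta> p (z - x\<^sub>0)\<close>, and conclude by Zorn's lemma on graphs.

  Conversely, a compatible family of balls in \<open>Y\<close> prescribes bounds for the distances from a new point to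
  \<open>Y\<close>, and these are met by an asymmetric norm on \<open>Y \<times> \<real>\<close>; extending the identity of \<open>Y\<close> maps the new
  point into all the balls. Here \<open>Y\<close> is closed in \<open>Y \<times> \<real>\<close> provided the radii are bounded away from 0.

  The ball property for radii bounded away from 0 implies the one for arbitrary nonnegative radii. It
  provides approximate order units \<open>u\<close>, with \<open>q u \<le> 1 + \<epsilon>\<close> and \<open>q (z - u) \<le> \<epsilon>\<close> whenever \<open>q z \<le> 1\<close>. For an
  exact order unit, \<open>q w \<le> r\<close> is equivalent to \<open>q (w + u) \<le> r + 1\<close>, so all radii can be raised by 1 at
  the price of shifting the centres by \<open>u\<close>.
\<close>

section \<open>The ball property\<close>

context asymmetric_normed_space
begin

lemma zero_in: "0 \<in> X"
  using subspace by (rule subspace_0)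

lemma zero [simp]: "p 0 = 0"
  using separating[OF zero_in] by simp

lemma add_in: "x \<in> X \<Longrightarrow> y \<in> X \<Longrightarrow> x + y \<in> X"
  using subspace by (rule subspace_add)

lemma diff_in: "x \<in> X \<Longrightarrow> y \<in> X \<Longrightarrow> x - y \<in> X"
  using subspace by (rule subspace_diff)

lemma neg_in: "x \<in> X \<Longrightarrow> - x \<in> X"
  using subspace by (rule subspace_neg)

lemma scale_in: "x \<in> X \<Longrightarrow> c *\<^sub>R x \<in> X"
  using subspace by (rule subspace_scale)

lemmas carrier = zero_in add_in diff_in neg_in scale_in

lemma triangle_le:
  assumes "z = x + y" "x \<in> X" "y \<in> X" "p x \<le> a" "p y \<le> b"
  shows "p z \<le> a + b"
  using triangle[of x y] assms by simp

lemma restrict: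
  assumes "subspace Z" "Z \<subseteq> X"
  shows "asymmetric_normed_space Z p"
  using assms subspace nonneg separating pos_homogeneous triangle
  by unfold_locales (auto simp: subset_iff)

end

text \<open>For positive radii the inequality \<open>q (y' - y) \<le> r + s'\<close> says that the
  two balls meet. The one-point extension yields the property for radii bounded below by some
  \<open>\<delta> > 0\<close>, whereas extending operators calls for \<open>\<delta> = 0\<close>,
  since the radii \<open>\<beta> * p (x0 - a)\<close> can vanish.\<close>

definition ball_property :: "real \<Rightarrow> 'b::real_vector set \<Rightarrow> ('b \<Rightarrow> real) \<Rightarrow> bool" where
  "ball_property \<delta> Y q \<longleftrightarrow>
     (\<forall>F. (\<forall>(y, r, s)\<in>F. y \<in> Y \<and> \<delta> \<le> r \<and> \<delta> \<le> s) \<longrightarrow>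
          (\<forall>(y, r, s)\<in>F. \<forall>(y', r', s')\<in>F. q (y' - y) \<le> r + s') \<longrightarrow>
          (\<exists>x\<in>Y. \<forall>(y, r, s)\<in>F. q (x - y) \<le> r \<and> q (y - x) \<le> s))"

lemma ball_propertyD:
  assumes "ball_property \<delta> Y q"
    and "\<And>y r s. (y, r, s) \<in> F \<Longrightarrow> y \<in> Y \<and> \<delta> \<le> r \<and> \<delta> \<le> s"
    and "\<And>y r s y' r' s'. (y, r, s) \<in> F \<Longrightarrow> (y', r', s') \<in> F \<Longrightarrow> q (y' - y) \<le> r + s'"
  obtains x where "x \<in> Y" "\<And>y r s. (y, r, s) \<in> F \<Longrightarrow> q (x - y) \<le> r \<and> q (y - x) \<le> s"
proof -
  have "\<exists>x\<in>Y. \<forall>(y, r, s)\<in>F. q (x - y) \<le> r \<and> q (y - x) \<le> s"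
    by (rule assms(1)[unfolded ball_property_def, rule_format])
      (use assms(2,3) in \<open>fastforce simp: split_beta\<close>)+
  then show ?thesis using that by fast
qed

section \<open>From intersecting balls to inequalities between norms\<close>

context asymmetric_normed_space
begin

text \<open>The point dividing the segment from \<open>y\<close> to \<open>y'\<close> in the ratio
  \<open>r : s'\<close> lies in both balls; the radii are positive because \<open>\<delta>\<close>
  is.\<close>

lemma mixed_BIP_imp_ball_property:
  assumes "mixed_BIP X p" "0 < \<delta>"
  shows "ball_property \<delta> X p"
  unfolding ball_property_def
proof (intro allI impI)
  fix F :: "('a \<times> real \<times> real) set"
  assume F: "\<forall>(y, r, s)\<in>F. y \<in> X \<and> \<delta> \<le> r \<and> \<delta> \<le> s"
    and le: "\<forall>(y, r, s)\<in>F. \<forall>(y', r', s')\<in>F. p (y' - y) \<le> r + s'"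
  have meet: "asym_cball X p y r \<inter> asym_cball X (conjugate p) y' s' \<noteq> {}"
    if "(y, r, s) \<in> F" "(y', r', s') \<in> F" for y r s y' r' s'
  proof -
    have yr: "y \<in> X" "y' \<in> X" "0 < r" "0 < s'" "p (y' - y) \<le> r + s'"
      using that F le \<open>0 < \<delta>\<close> by fastforce+
    define m where "m = r / (r + s')"
    have m: "0 \<le> m" "0 \<le> 1 - m" "m * (r + s') = r" "(1 - m) * (r + s') = s'"
      using yr by (auto simp: m_def field_simps)
    define z where "z = y + m *\<^sub>R (y' - y)"
    have "y' - z = (1 - m) *\<^sub>R (y' - y)"
      by (simp add: z_def algebra_simps)
    then have "p (y' - z) = (1 - m) * p (y' - y)"
      using yr m by (simp add: pos_homogeneous diff_in)
    moreover have "p (z - y) = m * p (y' - y)"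
      using yr m by (simp add: z_def pos_homogeneous diff_in)
    moreover have "m * p (y' - y) \<le> r" "(1 - m) * p (y' - y) \<le> s'"
      using mult_left_mono[OF yr(5) m(1)] mult_left_mono[OF yr(5) m(2)] m(3,4) by simp_all
    moreover have "z \<in> X"
      using yr by (simp add: z_def carrier)
    ultimately show ?thesis
      by (auto simp: asym_cball_def conjugate_def)
  qed
  have "(\<Inter>t\<in>F. asym_cball X p (fst t) (fst (snd t)) \<inter>
      asym_cball X (conjugate p) (fst t) (snd (snd t))) \<noteq> {}"
    by (rule mixed_BIP_any_index[OF assms(1)]) (use F meet assms(2) in fastforce)+
  then obtain x where x: "\<And>t. t \<in> F \<Longrightarrow> x \<in> asym_cball X p (fst t) (fst (snd t)) \<and>
      x \<in> asym_cball X (conjugate p) (fst t) (snd (snd t))"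
    by blast
  show "\<exists>x\<in>X. \<forall>(y, r, s)\<in>F. p (x - y) \<le> r \<and> p (y - x) \<le> s"
  \<comment> \<open>The intersection over an empty family is the whole type, so \<open>x\<close>
    need not lie in \<open>X\<close> then, and 0 is taken instead.\<close>
  proof (cases "F = {}")
    case True
    then show ?thesis using zero_in by auto
  next
    case False
    then have "x \<in> X" using x by (auto simp: asym_cball_def)
    then show ?thesis using x by (fastforce simp: asym_cball_def conjugate_def)
  qed
qed

text \<open>The triangle inequality through a common point of two balls turns their meeting into
  \<open>p (y j - y i) \<le> r i + s j\<close>.\<close>

lemma ball_property_imp_mixed_BIP:
  assumes "ball_property 0 X p"
  shows "mixed_BIP X p"
  unfolding mixed_BIP_def
proof (intro allI impI)
  fix I :: "('a \<times> real \<times> real) set" and y r s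
  assume I: "\<forall>i\<in>I. y i \<in> X \<and> 0 < r i \<and> 0 < s i"
    and meet: "\<forall>i\<in>I. \<forall>j\<in>I. asym_cball X p (y i) (r i) \<inter> asym_cball X (conjugate p) (y j) (s j) \<noteq> {}"
  have le: "p (y j - y i) \<le> r i + s j" if ij: "i \<in> I" "j \<in> I" for i j
  proof -
    obtain z where "z \<in> asym_cball X p (y i) (r i) \<inter> asym_cball X (conjugate p) (y j) (s j)"
      using meet ij by blast
    then have "z \<in> X" "p (z - y i) \<le> r i" "p (y j - z) \<le> s j"
      by (auto simp: asym_cball_def conjugate_def)
    then show ?thesis
      using I ij by (intro triangle_le[of _ "z - y i" "y j - z"]) (auto intro: diff_in)
  qed
  obtain x where "x \<in> X"
    and "\<And>y' r' s'. (y', r', s') \<in> (\<lambda>i. (y i, r i, s i)) ` I \<Longrightarrow> p (x - y') \<le> r' \<and> p (y' - x) \<le> s'"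
    by (rule ball_propertyD[OF assms, of "(\<lambda>i. (y i, r i, s i)) ` I"])
      (use I le in \<open>auto simp: less_imp_le\<close>)
  then have "x \<in> (\<Inter>i\<in>I. asym_cball X p (y i) (r i) \<inter> asym_cball X (conjugate p) (y i) (s i))"
    by (fastforce simp: asym_cball_def conjugate_def)
  then show "(\<Inter>i\<in>I. asym_cball X p (y i) (r i) \<inter> asym_cball X (conjugate p) (y i) (s i)) \<noteq> {}"
    by blast
qed

text \<open>A single intersection of balls supplies \<open>u\<close>: one ball around 0 bounds
  \<open>p u\<close>, and one around each \<open>z\<close> of the unit ball bounds
  \<open>p (z - u)\<close>.\<close>

lemma approximate_order_unit:
  assumes "\<And>\<delta>. 0 < \<delta> \<Longrightarrow> ball_property \<delta> X p" and "0 < \<epsilon>"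
  obtains u where "u \<in> X" "p u \<le> 1 + \<epsilon>" "\<And>z. z \<in> X \<Longrightarrow> p z \<le> 1 \<Longrightarrow> p (z - u) \<le> \<epsilon>"
proof -
  \<comment> \<open>The radii \<open>1 + \<epsilon>\<close> at 0 and \<open>\<epsilon>\<close> at
    \<open>z\<close> are the wanted bounds. The radius \<open>1 + p (- z)\<close> makes the centres
    in the unit ball compatible, as
    \<open>p (z' - z) \<le> p z' + p (- z) \<le> 1 + p (- z)\<close>.\<close>
  define F where "F = insert (0, 1 + \<epsilon>, 1) ((\<lambda>z. (z, 1 + p (- z), \<epsilon>)) ` {z\<in>X. p z \<le> 1})"
  have "ball_property (min 1 \<epsilon>) X p"
    using assms by simp
  then obtain u where u: "u \<in> X" "\<And>y r s. (y, r, s) \<in> F \<Longrightarrow> p (u - y) \<le> r \<and> p (y - u) \<le> s"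
  proof (rule ball_propertyD)
    show "y \<in> X \<and> min 1 \<epsilon> \<le> r \<and> min 1 \<epsilon> \<le> s" if "(y, r, s) \<in> F" for y r s
      using that zero_in nonneg neg_in \<open>0 < \<epsilon>\<close> by (fastforce simp: F_def)
    show "p (y' - y) \<le> r + s'" if "(y, r, s) \<in> F" "(y', r', s') \<in> F" for y r s y' r' s'
    proof -
      have "y \<in> X" "y' \<in> X" and *: "p y' \<le> s' \<and> y = 0 \<or> p y' \<le> 1 \<and> 0 < s' \<and> 1 + p (- y) \<le> r \<or>
          p y' \<le> 1 \<and> y = 0 \<and> 1 \<le> r \<and> 0 < s'" "0 < r"
        using that zero_in nonneg[OF neg_in] \<open>0 < \<epsilon>\<close> by (auto simp: F_def add_pos_nonneg)
      moreover have "p (y' - y) \<le> p y' + p (- y)"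
        using triangle[of y' "- y"] \<open>y \<in> X\<close> \<open>y' \<in> X\<close> by (simp add: neg_in)
      ultimately show ?thesis by auto
    qed
  qed blast
  have "(0, 1 + \<epsilon>, 1) \<in> F" "\<And>z. z \<in> X \<Longrightarrow> p z \<le> 1 \<Longrightarrow> (z, 1 + p (- z), \<epsilon>) \<in> F"
    by (auto simp: F_def)
  from u(2)[OF this(1)] u(2)[OF this(2)] show ?thesis
    using that[OF u(1)] by simp
qed

text \<open>Dividing \<open>w + u \<epsilon>\<close> by \<open>c = R + 1 + \<epsilon>\<close> brings
  it into the unit ball, so subtracting \<open>c\<close> times \<open>u \<epsilon>\<close> leaves
  \<open>p (w - (R + \<epsilon>) *\<^sub>R u \<epsilon>) \<le> c * \<epsilon>\<close>. Adding
  \<open>(R + \<epsilon>) *\<^sub>R u \<epsilon>\<close> back bounds \<open>p w\<close> by a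
  quantity that tends to \<open>R\<close>.\<close>

lemma le_of_approximate_order_units:
  assumes u: "\<And>\<epsilon>. 0 < \<epsilon> \<Longrightarrow> u \<epsilon> \<in> X \<and> p (u \<epsilon>) \<le> 1 + \<epsilon>"
    and unit: "\<And>\<epsilon> z. 0 < \<epsilon> \<Longrightarrow> z \<in> X \<Longrightarrow> p z \<le> 1 \<Longrightarrow> p (z - u \<epsilon>) \<le> \<epsilon>"
    and w: "w \<in> X" and R: "0 \<le> R"
    and le: "\<And>\<epsilon>. 0 < \<epsilon> \<Longrightarrow> p (w + u \<epsilon>) \<le> R + 1 + \<epsilon>"
  shows "p w \<le> R"
proof (rule tendsto_lowerbound)
  show "((\<lambda>\<epsilon>. (R + 1 + \<epsilon>) * \<epsilon> + (R + \<epsilon>) * (1 + \<epsilon>)) \<longlongrightarrow> R) (at_right 0)"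
    by (auto intro!: tendsto_eq_intros)
  show "\<forall>\<^sub>F \<epsilon> in at_right 0. p w \<le> (R + 1 + \<epsilon>) * \<epsilon> + (R + \<epsilon>) * (1 + \<epsilon>)"
  proof (rule eventually_at_rightI)
    fix \<epsilon> :: real
    assume "\<epsilon> \<in> {0<..<1}"
    then have e: "0 < \<epsilon>" by simp
    define c where "c = R + 1 + \<epsilon>"
    have c: "0 < c" using e R by (simp add: c_def)
    note ue = u[OF e]
    define z where "z = (1 / c) *\<^sub>R (w + u \<epsilon>)"
    have "p z \<le> 1"
      using le[OF e] c w ue by (simp add: z_def pos_homogeneous add_in c_def)
    then have "p (z - u \<epsilon>) \<le> \<epsilon>"
      using unit e w ue by (simp add: z_def carrier)
    then have "c * p (z - u \<epsilon>) \<le> c * \<epsilon>"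
      using c by simp
    moreover have "p (c *\<^sub>R (z - u \<epsilon>)) = c * p (z - u \<epsilon>)"
      using c w ue by (intro pos_homogeneous) (auto simp: z_def intro!: carrier)
    moreover have "c *\<^sub>R (z - u \<epsilon>) = w - (R + \<epsilon>) *\<^sub>R u \<epsilon>"
      using c by (simp add: z_def algebra_simps) (simp add: c_def algebra_simps)
    ultimately have "p (w - (R + \<epsilon>) *\<^sub>R u \<epsilon>) \<le> c * \<epsilon>"
      by simp
    moreover have "p ((R + \<epsilon>) *\<^sub>R u \<epsilon>) \<le> (R + \<epsilon>) * (1 + \<epsilon>)"
      using ue e R by (simp add: pos_homogeneous mult_left_mono)
    ultimately show "p w \<le> (R + 1 + \<epsilon>) * \<epsilon> + (R + \<epsilon>) * (1 + \<epsilon>)"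
      unfolding c_def[symmetric] using w ue
      by (intro triangle_le[of w "w - (R + \<epsilon>) *\<^sub>R u \<epsilon>" "(R + \<epsilon>) *\<^sub>R u \<epsilon>"]) (auto intro!: carrier)
  qed simp
qed simp

text \<open>The family \<open>G\<close> contains the shifted balls for all \<open>\<epsilon>\<close>
  at once. Hence one point \<open>x\<close> meets every shifted constraint, and the passage to the
  limit concerns only real bounds, never a sequence of points.\<close>

lemma ball_property_zero:
  assumes "\<And>\<delta>. 0 < \<delta> \<Longrightarrow> ball_property \<delta> X p"
  shows "ball_property 0 X p"
  unfolding ball_property_def
proof (intro allI impI)
  fix F :: "('a \<times> real \<times> real) set"
  assume F: "\<forall>(y, r, s)\<in>F. y \<in> X \<and> 0 \<le> r \<and> 0 \<le> s"
    and le: "\<forall>(y, r, s)\<in>F. \<forall>(y', r', s')\<in>F. p (y' - y) \<le> r + s'"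
  have "\<forall>\<epsilon>>0. \<exists>u. u \<in> X \<and> p u \<le> 1 + \<epsilon> \<and> (\<forall>z. z \<in> X \<longrightarrow> p z \<le> 1 \<longrightarrow> p (z - u) \<le> \<epsilon>)"
    using approximate_order_unit[OF assms] by metis
  then obtain u where u: "\<And>\<epsilon>. 0 < \<epsilon> \<Longrightarrow> u \<epsilon> \<in> X \<and> p (u \<epsilon>) \<le> 1 + \<epsilon>"
    and unit: "\<And>\<epsilon> z. 0 < \<epsilon> \<Longrightarrow> z \<in> X \<Longrightarrow> p z \<le> 1 \<Longrightarrow> p (z - u \<epsilon>) \<le> \<epsilon>"
    by metis
  text \<open>A constraint \<open>p (x - y) \<le> r\<close> becomes \<open>p (x - (y - u \<epsilon>)) \<le> r + 1 + \<epsilon>\<close> for all \<open>\<epsilon>\<close>, whose radii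
    are at least 1; the other radius attached to the same centre is merely kept large enough to be
    compatible.\<close>
  define G where "G = {(y - u \<epsilon>, r + (1 + \<epsilon>), s + (1 + p (- u \<epsilon>))) | y r s \<epsilon>. (y, r, s) \<in> F \<and> 0 < \<epsilon>} \<union>
    {(y + u \<epsilon>, r + (1 + p (- u \<epsilon>)), s + (1 + \<epsilon>)) | y r s \<epsilon>. (y, r, s) \<in> F \<and> 0 < \<epsilon>}"
  \<comment> \<open>Both kinds of triples are shifts by a vector \<open>v\<close>, equal to
    \<open>u \<epsilon>\<close> or \<open>- u \<epsilon>\<close>, whose two norms are covered by the
    increase of the radii. Compatibility in \<open>G\<close> then follows from that in
    \<open>F\<close> and \<open>p (v - v') \<le> p v + p (- v')\<close>.\<close>
  have shape: "\<exists>y0 r0 s0 v a b. (y0, r0, s0) \<in> F \<and> y = y0 - v \<and> r = r0 + a \<and> s = s0 + b \<and>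
      v \<in> X \<and> p v \<le> a \<and> p (- v) \<le> b \<and> 1 \<le> a \<and> 1 \<le> b" if "(y, r, s) \<in> G" for y r s
    using that unfolding G_def
  proof (elim UnE CollectE exE conjE)
    fix y' r' s' \<epsilon>
    assume F': "(y', r', s') \<in> F" and e: "0 < \<epsilon>" 
      and eq: "(y, r, s) = (y' - u \<epsilon>, r' + (1 + \<epsilon>), s' + (1 + p (- u \<epsilon>)))"
    show ?thesis
      by (rule exI[of _ y'], rule exI[of _ r'], rule exI[of _ s'], rule exI[of _ "u \<epsilon>"])
        (use F' e eq u[OF e] nonneg[OF neg_in] in auto)
  next
    fix y' r' s' \<epsilon>
    assume F': "(y', r', s') \<in> F" and e: "0 < \<epsilon>" 
      and eq: "(y, r, s) = (y' + u \<epsilon>, r' + (1 + p (- u \<epsilon>)), s' + (1 + \<epsilon>))"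
    show ?thesis
      by (rule exI[of _ y'], rule exI[of _ r'], rule exI[of _ s'], rule exI[of _ "- u \<epsilon>"])
        (use F' e eq u[OF e] nonneg[OF neg_in] neg_in in auto)
  qed
  have "ball_property 1 X p"
    using assms by simp
  then obtain x where x: "x \<in> X" "\<And>y r s. (y, r, s) \<in> G \<Longrightarrow> p (x - y) \<le> r \<and> p (y - x) \<le> s"
  proof (rule ball_propertyD)
    show "y \<in> X \<and> 1 \<le> r \<and> 1 \<le> s" if "(y, r, s) \<in> G" for y r s
      using shape[OF that] F by (fastforce intro: diff_in)
    show "p (y' - y) \<le> r + s'" if G: "(y, r, s) \<in> G" "(y', r', s') \<in> G" for y r s y' r' s'
    proof -
      obtain y0 r0 s0 v a b where 1: "(y0, r0, s0) \<in> F" "y = y0 - v" "r = r0 + a"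
        "v \<in> X" "p v \<le> a"
        using shape[OF G(1)] by blast
      obtain y1 r1 s1 v' a' b' where 2: "(y1, r1, s1) \<in> F" "y' = y1 - v'" "s' = s1 + b'"
        "v' \<in> X" "p (- v') \<le> b'"
        using shape[OF G(2)] by blast
      have F': "y0 \<in> X" "y1 \<in> X" "p (y1 - y0) \<le> r0 + s1"
        using 1 2 F le by fast+
      have v: "p (v - v') \<le> a + b'"
        by (rule triangle_le[of _ v "- v'"]) (use 1 2 neg_in in auto)
      have "p (y' - y) \<le> (r0 + s1) + (a + b')"
        by (rule triangle_le[of _ "y1 - y0" "v - v'"]) (use 1 2 F' v in \<open>simp_all add: diff_in\<close>)
      then show ?thesis using 1 2 by simp
    qed
  qed blast
  have "p (x - y) \<le> r \<and> p (y - x) \<le> s" if "(y, r, s) \<in> F" for y r s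
  proof (intro conjI; rule le_of_approximate_order_units[OF u unit])
    have yF: "y \<in> X" "0 \<le> r" "0 \<le> s" using that F by auto
    then show "x - y \<in> X" "y - x \<in> X" "0 \<le> r" "0 \<le> s" using x by (auto intro: diff_in)
    fix \<epsilon> :: real assume "0 < \<epsilon>"
    then have "(y - u \<epsilon>, r + (1 + \<epsilon>), s + (1 + p (- u \<epsilon>))) \<in> G"
      "(y + u \<epsilon>, r + (1 + p (- u \<epsilon>)), s + (1 + \<epsilon>)) \<in> G"
      using that by (auto simp: G_def)
    from x(2)[OF this(1)] x(2)[OF this(2)]
    show "p (x - y + u \<epsilon>) \<le> r + 1 + \<epsilon>" "p (y - x + u \<epsilon>) \<le> s + 1 + \<epsilon>"
      by (simp_all add: algebra_simps)
  qed
  then show "\<exists>x\<in>X. \<forall>(y, r, s)\<in>F. p (x - y) \<le> r \<and> p (y - x) \<le> s"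
    using x(1) by blast
qed

end

section \<open>Extension of operators\<close>

lemma topspace_asym_topology: "topspace (asym_topology X p) = X"
proof
  show "topspace (asym_topology X p) \<subseteq> X"
    unfolding topspace_def openin_asym_topology by blast
  have "openin (asym_topology X p) X"
    unfolding openin_asym_topology asym_ball_def using zero_less_one by blast
  then show "X \<subseteq> topspace (asym_topology X p)"
    by (rule openin_subset)
qed

text \<open>By continuity at 0 some ball \<open>p x < r\<close> is mapped into \<open>q < 1\<close>;
  rescaling spreads this bound over \<open>X\<close>.\<close>

lemma continuous_linear_operator_imp_bounded:
  assumes "asymmetric_normed_space X p" "asymmetric_normed_space Y q"
    and A: "continuous_linear_operator X p Y q A"
  obtains \<beta> where "0 \<le> \<beta>" "\<And>x. x \<in> X \<Longrightarrow> q (A x) \<le> \<beta> * p x"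
proof -
  interpret X: asymmetric_normed_space X p by fact
  interpret Y: asymmetric_normed_space Y q by fact
  have AY: "A x \<in> Y" if "x \<in> X" for x
    using A that by (auto simp: continuous_linear_operator_def)
  have scale: "A (c *\<^sub>R x) = c *\<^sub>R A x" if "x \<in> X" for c x
    using A that by (auto simp: continuous_linear_operator_def linear_on_def)
  have A0: "A 0 = 0"
    using scale[OF X.zero_in, of 0] by simp
  obtain U where U: "openin (asym_topology Y q) U" "0 \<in> U" "U \<subseteq> asym_ball Y q 0 1"
    using Y.neighbourhood_asym_topology[OF Y.zero_in, of "asym_ball Y q 0 1"]
    by (auto simp: asym_ball_def intro: exI[of _ 1])
  have "openin (asym_topology X p) {x \<in> X. A x \<in> U}"
    using A U(1) by (auto simp: continuous_linear_operator_def continuous_map_def topspace_asym_topology)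
  then obtain r where r: "0 < r" "asym_ball X p 0 r \<subseteq> {x \<in> X. A x \<in> U}"
    using U(2) A0 X.zero_in unfolding openin_asym_topology by force
  have small: "q (A x) < 1" if "x \<in> X" "p x < r" for x
    using that r U(3) by (auto simp: asym_ball_def)
  have "q (A x) \<le> 2 / r * p x" if x: "x \<in> X" for x
  proof (rule field_le_epsilon)
    fix e :: real
    assume "0 < e"
    \<comment> \<open>As \<open>p x\<close> may be 0, the divisor of \<open>x\<close> is kept
      positive by the summand \<open>e\<close>, which is arbitrarily small.\<close>
    define k where "k = 2 / r * p x + e"
    have "0 < k"
      using \<open>0 < e\<close> r(1) X.nonneg[OF x] by (simp add: k_def add_nonneg_pos)
    have "r * k = 2 * p x + r * e"
      using r(1) by (simp add: k_def field_simps)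
    moreover have "0 < r * e"
      using \<open>0 < e\<close> r(1) by simp
    ultimately have "p x < r * k"
      using X.nonneg[OF x] by linarith
    then have "p ((1 / k) *\<^sub>R x) < r"
      using \<open>0 < k\<close> by (simp add: X.pos_homogeneous x field_simps)
    then have "q ((1 / k) *\<^sub>R A x) < 1"
      using small x scale X.scale_in by metis
    then have "q (A x) \<le> k"
      using \<open>0 < k\<close> by (simp add: Y.pos_homogeneous AY x)
    then show "q (A x) \<le> 2 / r * p x + e"
      by (simp add: k_def)
  qed
  then show ?thesis
    using that[of "2 / r"] r(1) by simp
qed

lemma bounded_imp_continuous_linear_operator:
  assumes "asymmetric_normed_space X p" "asymmetric_normed_space Y q"
    and A: "A \<in> X \<rightarrow> Y" "linear_on X A"
    and \<beta>: "0 \<le> \<beta>" "\<And>x. x \<in> X \<Longrightarrow> q (A x) \<le> \<beta> * p x"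
  shows "continuous_linear_operator X p Y q A"
proof -
  interpret X: asymmetric_normed_space X p by fact
  interpret Y: asymmetric_normed_space Y q by fact
  have diff: "A (x - y) = A x - A y" if "x \<in> X" "y \<in> X" for x y
  proof -
    have "A (x + (-1) *\<^sub>R y) = A x + (-1) *\<^sub>R A y"
      using A(2) that X.scale_in[of y "-1"] unfolding linear_on_def by metis
    then show ?thesis by simp
  qed
  have "openin (asym_topology X p) {x \<in> X. A x \<in> U}" if U: "openin (asym_topology Y q) U" for U
    unfolding openin_asym_topology
  proof (intro conjI ballI)
    fix x
    assume x: "x \<in> {x \<in> X. A x \<in> U}"
    then obtain r where r: "0 < r" "asym_ball Y q (A x) r \<subseteq> U"
      using U unfolding openin_asym_topology by blast
    \<comment> \<open>Using \<open>\<beta> + 1\<close> in place of \<open>\<beta>\<close> avoids a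
      division by 0.\<close>
    have "asym_ball X p x (r / (\<beta> + 1)) \<subseteq> {x \<in> X. A x \<in> U}"
    proof
      fix y
      assume y: "y \<in> asym_ball X p x (r / (\<beta> + 1))"
      then have yX: "y \<in> X" and py: "p (y - x) * (\<beta> + 1) < r"
        using \<beta>(1) by (auto simp: asym_ball_def pos_less_divide_eq)
      have xX: "x \<in> X" using x by simp
      have "q (A y - A x) \<le> \<beta> * p (y - x)"
        using \<beta>(2)[of "y - x"] diff xX yX X.diff_in by simp
      also have "\<dots> \<le> p (y - x) * (\<beta> + 1)"
        using X.nonneg[OF X.diff_in[OF yX xX]] by (simp add: algebra_simps)
      finally have "A y \<in> asym_ball Y q (A x) r"
        using py yX A(1) by (auto simp: asym_ball_def)
      then show "y \<in> {x \<in> X. A x \<in> U}"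
        using r yX by auto
    qed
    then show "\<exists>r>0. asym_ball X p x r \<subseteq> {x \<in> X. A x \<in> U}"
      using r(1) \<beta>(1) by (intro exI[of _ "r / (\<beta> + 1)"]) auto
  qed simp
  then show ?thesis
    using A by (auto simp: continuous_linear_operator_def continuous_map_def topspace_asym_topology)
qed

text \<open>\<open>LEAST\<close> is meaningful on the reals only if a smallest bound exists, so the
  infimum of the set \<open>B\<close> of bounds is shown to belong to \<open>B\<close>. Where
  \<open>p x\<close> is positive one divides by it; where \<open>p x = 0\<close>, any single bound
  gives \<open>q (A x) \<le> 0\<close>.\<close>

lemma asym_opnorm:
  assumes "asymmetric_normed_space X p" "asymmetric_normed_space Y q"
    and "continuous_linear_operator X p Y q A"
  shows asym_opnorm_nonneg: "0 \<le> asym_opnorm X p q A"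
    and asym_opnorm_bound: "\<And>x. x \<in> X \<Longrightarrow> q (A x) \<le> asym_opnorm X p q A * p x"
    and asym_opnorm_le: "\<And>\<beta>. 0 \<le> \<beta> \<Longrightarrow> (\<And>x. x \<in> X \<Longrightarrow> q (A x) \<le> \<beta> * p x) \<Longrightarrow> asym_opnorm X p q A \<le> \<beta>"
proof -
  interpret X: asymmetric_normed_space X p by fact
  interpret Y: asymmetric_normed_space Y q by fact
  define B where "B = {\<beta>. 0 \<le> \<beta> \<and> (\<forall>x\<in>X. q (A x) \<le> \<beta> * p x)}"
  obtain \<beta> where "0 \<le> \<beta>" "\<And>x. x \<in> X \<Longrightarrow> q (A x) \<le> \<beta> * p x"
    using continuous_linear_operator_imp_bounded[OF assms] by blast
  then have "\<beta> \<in> B"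
    by (simp add: B_def)
  then have B: "B \<noteq> {}" "bdd_below B"
    by (auto simp: B_def intro: bdd_belowI[of _ 0])
  have lower: "Inf B \<le> \<beta>" if "\<beta> \<in> B" for \<beta>
    using that B(2) by (rule cInf_lower)
  have "0 \<le> Inf B"
    using B(1) by (rule cInf_greatest) (simp add: B_def)
  moreover have "q (A x) \<le> Inf B * p x" if x: "x \<in> X" for x
  proof (cases "p x = 0")
    case True
    then show ?thesis using B(1) x by (auto simp: B_def)
  next
    case False
    then have "0 < p x" using X.nonneg[OF x] by simp
    then have "q (A x) / p x \<le> Inf B"
      using B(1) x by (intro cInf_greatest) (auto simp: B_def divide_le_eq)
    then show ?thesis using \<open>0 < p x\<close> by (simp add: divide_le_eq)
  qed
  ultimately have "Inf B \<in> B" by (simp add: B_def)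
  moreover have "asym_opnorm X p q A = Inf B"
    unfolding asym_opnorm_def
    by (rule Least_equality) (use \<open>Inf B \<in> B\<close> lower in \<open>auto simp: B_def\<close>)
  ultimately show "0 \<le> asym_opnorm X p q A" "\<And>x. x \<in> X \<Longrightarrow> q (A x) \<le> asym_opnorm X p q A * p x"
    "\<And>\<beta>. 0 \<le> \<beta> \<Longrightarrow> (\<And>x. x \<in> X \<Longrightarrow> q (A x) \<le> \<beta> * p x) \<Longrightarrow> asym_opnorm X p q A \<le> \<beta>"
    using lower by (auto simp: B_def)
qed

text \<open>Partial operators are represented by their graphs. The balls for \<open>y\<close> are
  compatible by the triangle inequality through \<open>x0\<close>. A case distinction on whether
  \<open>x0\<close> is already in the domain is avoided: if \<open>(x0, b)\<close> is in
  \<open>G\<close>, the radii 0 force \<open>y = b\<close>.\<close>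

lemma dominated_subspace_extend:
  assumes "asymmetric_normed_space X p" "asymmetric_normed_space Y q" "ball_property 0 Y q"
    and \<beta>: "0 \<le> \<beta>" and G: "subspace G" "G \<subseteq> X \<times> Y"
    and dom: "\<And>a b. (a, b) \<in> G \<Longrightarrow> q b \<le> \<beta> * p a"
    and x0: "x0 \<in> X"
  obtains G' y where "subspace G'" "G' \<subseteq> X \<times> Y" "\<And>a b. (a, b) \<in> G' \<Longrightarrow> q b \<le> \<beta> * p a"
    "G \<subseteq> G'" "(x0, y) \<in> G'"
proof -
  interpret X: asymmetric_normed_space X p by fact
  interpret Y: asymmetric_normed_space Y q by fact
  define F where "F = (\<lambda>(a, b). (b, \<beta> * p (x0 - a), \<beta> * p (a - x0))) ` G"
  obtain y where y: "y \<in> Y" "\<And>b r s. (b, r, s) \<in> F \<Longrightarrow> q (y - b) \<le> r \<and> q (b - y) \<le> s"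
    using assms(3)
  proof (rule ball_propertyD)
    show "b \<in> Y \<and> 0 \<le> r \<and> 0 \<le> s" if "(b, r, s) \<in> F" for b r s
      using that G(2) \<beta> x0 by (auto simp: F_def intro!: mult_nonneg_nonneg X.nonneg X.diff_in)
    show "q (b' - b) \<le> r + s'" if bF: "(b, r, s) \<in> F" "(b', r', s') \<in> F" for b r s b' r' s'
    proof -
      obtain a a' where a: "(a, b) \<in> G" "(a', b') \<in> G" "r = \<beta> * p (x0 - a)" "s' = \<beta> * p (a' - x0)"
        using bF by (auto simp: F_def)
      have "(a' - a, b' - b) \<in> G"
        using subspace_diff[OF G(1) a(2,1)] by simp
      then have "q (b' - b) \<le> \<beta> * p (a' - a)" by (rule dom)
      also have "p (a' - a) \<le> p (x0 - a) + p (a' - x0)"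
        by (rule X.triangle_le[of _ "x0 - a" "a' - x0"]) (use a G(2) x0 X.diff_in in auto)
      finally show ?thesis
        using a \<beta> by (simp add: mult_left_mono distrib_left)
    qed
  qed blast
  have y': "q (y - b) \<le> \<beta> * p (x0 - a)" "q (b - y) \<le> \<beta> * p (a - x0)" if "(a, b) \<in> G" for a b
    using y(2)[of b "\<beta> * p (x0 - a)" "\<beta> * p (a - x0)"] that by (force simp: F_def)+
  define G' where "G' = {g + h | g h. g \<in> G \<and> h \<in> span {(x0, y)}}"
  show ?thesis
  proof
    show "subspace G'"
      unfolding G'_def by (intro subspace_sums G(1) subspace_span)
    show "G \<subseteq> G'"
    proof
      fix g assume "g \<in> G"
      then have "g + 0 \<in> G'"
        unfolding G'_def using span_zero by blast
      then show "g \<in> G'" by simp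
    qed
    show "(x0, y) \<in> G'"
    proof -
      have "0 + (x0, y) \<in> G'"
        unfolding G'_def using subspace_0[OF G(1)] span_base[of "(x0, y)" "{(x0, y)}"] by blast
      then show ?thesis by simp
    qed
    have elem: "\<exists>a' b' c. (a', b') \<in> G \<and> a = a' + c *\<^sub>R x0 \<and> b = b' + c *\<^sub>R y"
      if "(a, b) \<in> G'" for a b
      using that by (force simp: G'_def span_singleton)
    show "G' \<subseteq> X \<times> Y"
      using elem G(2) x0 y(1) by (fastforce intro: X.carrier Y.carrier)
    show "q b \<le> \<beta> * p a" if ab: "(a, b) \<in> G'" for a b
    proof -
      obtain a' b' c where *: "(a', b') \<in> G" "a = a' + c *\<^sub>R x0" "b = b' + c *\<^sub>R y"
        using elem[OF ab] by blast
      have in_XY: "a' \<in> X" "b' \<in> Y" using * G(2) by auto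
      have scaled: "((1 / k) *\<^sub>R a', (1 / k) *\<^sub>R b') \<in> G" for k
        using subspace_scale[OF G(1) *(1), of "1 / k"] by simp
      \<comment> \<open>The sign of \<open>c\<close> decides which of the two inequalities for
        \<open>y\<close> applies, after division by the absolute value of \<open>c\<close>; in both
        cases the element of \<open>G\<close> used is \<open>1 / - c\<close> times
        \<open>(a', b')\<close>.\<close>
      consider "c = 0" | "0 < c" | "c < 0" by linarith
      then show ?thesis
      proof cases
        case 1
        then show ?thesis using dom * by simp
      next
        case 2
        have "q (c *\<^sub>R (y - (1 / - c) *\<^sub>R b')) = c * q (y - (1 / - c) *\<^sub>R b')"
          using 2 in_XY y(1) by (intro Y.pos_homogeneous) (auto intro: Y.carrier)
        also have "\<dots> \<le> c * (\<beta> * p (x0 - (1 / - c) *\<^sub>R a'))"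
          using y'(1)[OF scaled] by (rule mult_left_mono) (use 2 in simp)
        also have "\<dots> = \<beta> * p (c *\<^sub>R (x0 - (1 / - c) *\<^sub>R a'))"
          using 2 in_XY x0 by (subst X.pos_homogeneous) (auto intro: X.carrier)
        finally show ?thesis
          using 2 * by (simp add: algebra_simps)
      next
        case 3
        have "q ((- c) *\<^sub>R ((1 / - c) *\<^sub>R b' - y)) = - c * q ((1 / - c) *\<^sub>R b' - y)"
          using 3 in_XY y(1) by (intro Y.pos_homogeneous) (auto intro: Y.carrier)
        also have "\<dots> \<le> - c * (\<beta> * p ((1 / - c) *\<^sub>R a' - x0))"
          using y'(2)[OF scaled] by (rule mult_left_mono) (use 3 in simp)
        also have "\<dots> = \<beta> * p ((- c) *\<^sub>R ((1 / - c) *\<^sub>R a' - x0))"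
          using 3 in_XY x0 by (subst X.pos_homogeneous) (auto intro: X.carrier)
        finally show ?thesis
          using 3 * by (simp add: algebra_simps)
      qed
    qed
  qed
qed

lemma subspace_Union_chain:
  assumes "C \<noteq> {}" "subset.chain {G. subspace G} C"
  shows "subspace (\<Union>C)"
proof (rule subspaceI)
  obtain G where "G \<in> C" "subspace G"
    using assms unfolding subset_chain_def by blast
  then show "0 \<in> \<Union>C"
    using subspace_0 by blast
  show "x + y \<in> \<Union>C" if xy: "x \<in> \<Union>C" "y \<in> \<Union>C" for x y
  proof -
    obtain G where "G \<in> C" "x \<in> G" "y \<in> G"
      using xy assms(2) unfolding subset_chain_def by blast
    then show ?thesis
      using assms(2) by (auto simp: subset_chain_def intro: subspace_add)
  qed
  show "c *\<^sub>R x \<in> \<Union>C" if "x \<in> \<Union>C" for c x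
    using that assms(2) by (auto simp: subset_chain_def intro: subspace_scale)
qed

text \<open>A maximal dominated subspace containing the graph of \<open>T\<close> is the graph of
  \<open>S\<close>: it reaches every \<open>x\<close> by the one-vector extension, and domination
  makes it single-valued.\<close>

lemma dominated_extension:
  assumes "asymmetric_normed_space X p" "asymmetric_normed_space Y q" "ball_property 0 Y q"
    and \<beta>: "0 \<le> \<beta>" and Z: "subspace Z" "Z \<subseteq> X"
    and T: "T \<in> Z \<rightarrow> Y" "linear_on Z T" "\<And>z. z \<in> Z \<Longrightarrow> q (T z) \<le> \<beta> * p z"
  obtains S where "S \<in> X \<rightarrow> Y" "linear_on X S" "\<And>x. x \<in> X \<Longrightarrow> q (S x) \<le> \<beta> * p x"
    "\<And>z. z \<in> Z \<Longrightarrow> S z = T z"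
proof -
  interpret X: asymmetric_normed_space X p by fact
  interpret Y: asymmetric_normed_space Y q by fact
  define graph where "graph = (\<lambda>z. (z, T z)) ` Z"
  have Tadd: "T (x + y) = T x + T y" and Tscale: "T (c *\<^sub>R x) = c *\<^sub>R T x"
    if "x \<in> Z" "y \<in> Z" for c x y
    using T(2) that by (auto simp: linear_on_def)
  define \<G> where "\<G> = {G. subspace G \<and> G \<subseteq> X \<times> Y \<and> (\<forall>(a, b)\<in>G. q b \<le> \<beta> * p a) \<and> graph \<subseteq> G}"
  have "subspace graph"
  proof (rule subspaceI)
    show "0 \<in> graph"
      using subspace_0[OF Z(1)] Tscale[of 0 0 0] by (force simp: graph_def zero_prod_def)
    show "x + y \<in> graph" if "x \<in> graph" "y \<in> graph" for x y
      using that Z(1) by (auto simp: graph_def Tadd image_iff intro: subspace_add)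
    show "c *\<^sub>R x \<in> graph" if "x \<in> graph" for c x
      using that Z(1) by (auto simp: graph_def Tscale image_iff intro: subspace_scale)
  qed
  then have "graph \<in> \<G>"
    using Z T by (auto simp: \<G>_def graph_def)
  have "\<exists>M\<in>\<G>. \<forall>G\<in>\<G>. M \<subseteq> G \<longrightarrow> G = M"
  proof (rule subset_Zorn_nonempty)
    show "\<G> \<noteq> {}" using \<open>graph \<in> \<G>\<close> by blast
    fix C
    assume C: "C \<noteq> {}" "subset.chain \<G> C"
    have "subspace (\<Union>C)"
      using C by (intro subspace_Union_chain) (auto simp: subset_chain_def \<G>_def)
    moreover have "C \<subseteq> \<G>" using C(2) by (simp add: subset_chain_def)
    ultimately show "\<Union>C \<in> \<G>"
      using C(1) by (fastforce simp: \<G>_def)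
  qed
  then obtain M where M: "M \<in> \<G>" and maximal: "\<And>G. G \<in> \<G> \<Longrightarrow> M \<subseteq> G \<Longrightarrow> G = M"
    by blast
  have M': "subspace M" "M \<subseteq> X \<times> Y" "\<And>a b. (a, b) \<in> M \<Longrightarrow> q b \<le> \<beta> * p a" "graph \<subseteq> M"
    using M by (auto simp: \<G>_def)
  have total: "\<exists>y. (x, y) \<in> M" if "x \<in> X" for x
  proof -
    obtain G' y where G': "subspace G'" "G' \<subseteq> X \<times> Y" "\<And>a b. (a, b) \<in> G' \<Longrightarrow> q b \<le> \<beta> * p a"
      "M \<subseteq> G'" "(x, y) \<in> G'"
      using dominated_subspace_extend[OF assms(1-3) \<beta> M'(1-3) \<open>x \<in> X\<close>] by blast
    then have "G' \<in> \<G>" using M'(4) by (auto simp: \<G>_def)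
    then show ?thesis using maximal G'(4,5) by blast
  qed
  \<comment> \<open>For \<open>(0, b)\<close> in \<open>M\<close> domination gives
    \<open>q b \<le> \<beta> * p 0 = 0\<close>, and likewise for \<open>- b\<close>, so separation
    yields \<open>b = 0\<close>.\<close>
  have unique: "y = y'" if y: "(x, y) \<in> M" "(x, y') \<in> M" for x y y'
  proof -
    have "(0, y - y') \<in> M" "(0, - (y - y')) \<in> M"
      using subspace_diff[OF M'(1) y] subspace_diff[OF M'(1) y(2,1)] by simp_all
    then have "q (y - y') \<le> 0" "q (- (y - y')) \<le> 0" "y - y' \<in> Y"
      using M'(2,3) by fastforce+
    then have "y - y' = 0"
      using Y.separating[of "y - y'"] Y.nonneg Y.neg_in by (meson order_antisym)
    then show ?thesis by simp
  qed
  define S where "S x = (SOME y. (x, y) \<in> M)" for x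
  have S: "(x, S x) \<in> M" if "x \<in> X" for x
    unfolding S_def using someI_ex[OF total[OF that]] .
  show ?thesis
  proof
    show "S \<in> X \<rightarrow> Y" using S M'(2) by auto
    show "linear_on X S"
      unfolding linear_on_def
    proof (intro conjI ballI allI)
      show "S (x + y) = S x + S y" if "x \<in> X" "y \<in> X" for x y
        using subspace_add[OF M'(1) S[OF that(1)] S[OF that(2)]] S[OF X.add_in[OF that]]
        by (auto intro: unique)
      show "S (c *\<^sub>R x) = c *\<^sub>R S x" if "x \<in> X" for c x
        using subspace_scale[OF M'(1) S[OF that], of c] S[OF X.scale_in[OF that, of c]]
        by (auto intro: unique)
    qed
    show "q (S x) \<le> \<beta> * p x" if "x \<in> X" for x
      using M'(3) S that by blast
    show "S z = T z" if "z \<in> Z" for z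
      using that Z(2) M'(4) by (intro unique[OF S]) (auto simp: graph_def)
  qed
qed

text \<open>Taking the norm of \<open>T\<close> as \<open>\<beta>\<close> gives one inequality
  between the norms; the other holds because a bound for \<open>S\<close> is also one for its
  restriction \<open>T\<close>.\<close>

lemma ball_property_imp_extension:
  assumes "asymmetric_normed_space Y q" "ball_property 0 Y q"
  shows "norm_preserving_extension_property TYPE('a::real_vector) Y q"
  unfolding norm_preserving_extension_property_def
proof (intro allI impI)
  fix X :: "'a set" and p Z T
  assume X: "asymmetric_normed_space X p" and Z: "subspace Z" "Z \<subseteq> X"
    and T: "continuous_linear_operator Z p Y q T"
  have Zp: "asymmetric_normed_space Z p"
    using X Z by (rule asymmetric_normed_space.restrict)
  note T_norm = asym_opnorm[OF Zp assms(1) T]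
  have T': "T \<in> Z \<rightarrow> Y" "linear_on Z T"
    using T by (auto simp: continuous_linear_operator_def)
  obtain S where S: "S \<in> X \<rightarrow> Y" "linear_on X S"
    "\<And>x. x \<in> X \<Longrightarrow> q (S x) \<le> asym_opnorm Z p q T * p x" "\<And>z. z \<in> Z \<Longrightarrow> S z = T z"
    using dominated_extension[OF X assms T_norm(1) Z T' T_norm(2)] by blast
  have cont: "continuous_linear_operator X p Y q S"
    using bounded_imp_continuous_linear_operator[OF X assms(1) S(1,2) T_norm(1) S(3)] .
  note S_norm = asym_opnorm[OF X assms(1) cont]
  have "asym_opnorm X p q S = asym_opnorm Z p q T"
  proof (rule antisym)
    show "asym_opnorm X p q S \<le> asym_opnorm Z p q T"
      using S_norm(3) T_norm(1) S(3) by blast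
    show "asym_opnorm Z p q T \<le> asym_opnorm X p q S"
      using S_norm(1,2) Z(2) S(4) by (intro T_norm(3)) (auto simp: subset_iff S(4)[symmetric])
  qed
  then show "\<exists>S. continuous_linear_operator X p Y q S \<and> (\<forall>z\<in>Z. S z = T z) \<and>
      asym_opnorm X p q S = asym_opnorm Z p q T"
    using cont S(4) by blast
qed

section \<open>One-point extensions of asymmetric norms\<close>

text \<open>A pair \<open>(x, k)\<close> in \<open>W\<close> is read as: \<open>x\<close> is
  available at cost \<open>k\<close>. The gauge is the least cost, that is, the lower boundary of
  \<open>W\<close>, and is sublinear when \<open>W\<close> is a convex cone of nonnegative costs.
  \<open>Inf\<close> of an empty set carries no information, so the lemmas ask for some pair over
  \<open>x\<close>.\<close>

definition gauge_of :: "('c::real_vector \<times> real) set \<Rightarrow> 'c \<Rightarrow> real" where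
  "gauge_of W x = Inf {k. (x, k) \<in> W}"

locale nonneg_cone =
  fixes W :: "('c::real_vector \<times> real) set"
  assumes cone: "convex_cone W" and cost_nonneg: "(x, k) \<in> W \<Longrightarrow> 0 \<le> k"
begin

lemma gauge_of_le: "(x, k) \<in> W \<Longrightarrow> gauge_of W x \<le> k"
  unfolding gauge_of_def using cost_nonneg by (intro cInf_lower) (auto intro: bdd_belowI[of _ 0])

lemma le_gauge_of:
  assumes "(x, k) \<in> W" "\<And>k. (x, k) \<in> W \<Longrightarrow> m \<le> k"
  shows "m \<le> gauge_of W x"
  unfolding gauge_of_def using assms by (intro cInf_greatest) auto

lemma gauge_of_add:
  assumes "(x, k) \<in> W" "(y, l) \<in> W"
  shows "gauge_of W (x + y) \<le> gauge_of W x + gauge_of W y"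
proof -
  have sum: "gauge_of W (x + y) \<le> i + j" if "(x, i) \<in> W" "(y, j) \<in> W" for i j
    using gauge_of_le convex_cone_add[OF cone that] by simp
  have "gauge_of W (x + y) - i \<le> gauge_of W y" if "(x, i) \<in> W" for i
  proof (rule le_gauge_of[OF assms(2)])
    show "gauge_of W (x + y) - i \<le> j" if "(y, j) \<in> W" for j
      using sum[OF \<open>(x, i) \<in> W\<close> that] by simp
  qed
  then have "gauge_of W (x + y) - gauge_of W y \<le> gauge_of W x"
    by (intro le_gauge_of[OF assms(1)]) (simp add: algebra_simps)
  then show ?thesis by simp
qed

lemma gauge_of_0: "gauge_of W 0 = 0"
proof (rule antisym)
  have "(0, 0) \<in> W"
    using convex_cone_contains_0[OF cone] by (simp add: zero_prod_def)
  then show "gauge_of W 0 \<le> 0" "0 \<le> gauge_of W 0"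
    by (auto intro: gauge_of_le le_gauge_of cost_nonneg)
qed

lemma gauge_of_scaleR_le:
  assumes "(x, k) \<in> W" "0 < c"
  shows "gauge_of W (c *\<^sub>R x) \<le> c * gauge_of W x"
proof -
  have "gauge_of W (c *\<^sub>R x) / c \<le> i" if "(x, i) \<in> W" for i
    using gauge_of_le[of "c *\<^sub>R x" "c * i"] convex_cone_scaleR[OF cone _ that, of c] assms(2)
    by (simp add: divide_le_eq mult.commute)
  then have "gauge_of W (c *\<^sub>R x) / c \<le> gauge_of W x"
    using le_gauge_of[OF assms(1)] by blast
  then show ?thesis
    using assms(2) by (simp add: divide_le_eq mult.commute)
qed

text \<open>The inequality for the factor \<open>c\<close> at \<open>x\<close> and the one for
  \<open>1 / c\<close> at \<open>c *\<^sub>R x\<close> together give equality.\<close>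

lemma gauge_of_scaleR:
  assumes "(x, k) \<in> W" "0 \<le> c"
  shows "gauge_of W (c *\<^sub>R x) = c * gauge_of W x"
proof (cases "c = 0")
  case True
  then show ?thesis by (simp add: gauge_of_0)
next
  case False
  with assms have c: "0 < c" by simp
  have "(c *\<^sub>R x, c * k) \<in> W"
    using convex_cone_scaleR[OF cone assms(2,1)] by simp
  from gauge_of_scaleR_le[OF this, of "1 / c"] c
  have "c * gauge_of W x \<le> gauge_of W (c *\<^sub>R x)"
    by (simp add: field_simps)
  then show ?thesis
    using gauge_of_scaleR_le[OF assms(1) c] by simp
qed

end

section \<open>Convex cones of vectors with costs\<close>

context asymmetric_normed_space
begin

lemma convex_cone_epigraph: "convex_cone {((u, t::real), c). u \<in> X \<and> t = 0 \<and> p u \<le> c}" (is "convex_cone ?S")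
  unfolding convex_cone_iff
proof (intro conjI ballI allI impI)
  show "x + y \<in> ?S" if "x \<in> ?S" "y \<in> ?S" for x y
    using that by (auto simp: add_in intro: triangle_le[OF refl])
qed (auto simp: zero_prod_def carrier pos_homogeneous mult_left_mono)

text \<open>This is the homogeneous form of the compatibility condition: for
  \<open>(w, \<alpha>, c) = (- y, 1, r)\<close> and \<open>(v, b, d) = (y', - 1, s')\<close> it
  reads \<open>p (y' - y) \<le> r + s'\<close>. With one argument fixed it is a conic condition on
  the other, so it passes from generators to their hull.\<close>

lemma convex_cone_pairing:
  assumes "w \<in> X"
  shows "convex_cone {((v, b), d). v \<in> X \<and> p (\<alpha> *\<^sub>R v - b *\<^sub>R w) \<le> \<alpha> * d - b * c}"
  (is "convex_cone ?S")
  unfolding convex_cone_iff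
proof (intro conjI ballI allI impI)
  show "0 \<in> ?S" by (simp add: zero_prod_def zero_in)
  show "x + y \<in> ?S" if "x \<in> ?S" "y \<in> ?S" for x y
  proof -
    obtain v b d v' b' d' where xy: "x = ((v, b), d)" "y = ((v', b'), d')"
      by (metis prod.exhaust)
    have "p (\<alpha> *\<^sub>R (v + v') - (b + b') *\<^sub>R w) \<le> (\<alpha> * d - b * c) + (\<alpha> * d' - b' * c)"
      by (rule triangle_le[of _ "\<alpha> *\<^sub>R v - b *\<^sub>R w" "\<alpha> *\<^sub>R v' - b' *\<^sub>R w"])
        (use that xy assms in \<open>auto simp: algebra_simps carrier\<close>)
    then show ?thesis
      using that by (simp add: xy add_in algebra_simps)
  qed
  show "k *\<^sub>R x \<in> ?S" if "x \<in> ?S" "0 \<le> k" for x k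
  proof -
    obtain v b d where x: "x = ((v, b), d)"
      by (metis prod.exhaust)
    have "\<alpha> *\<^sub>R v - b *\<^sub>R w \<in> X"
      using that(1) assms by (simp add: x carrier)
    then have "p (k *\<^sub>R (\<alpha> *\<^sub>R v - b *\<^sub>R w)) = k * p (\<alpha> *\<^sub>R v - b *\<^sub>R w)"
      using that(2) by (rule pos_homogeneous)
    also have "\<dots> \<le> k * (\<alpha> * d - b * c)"
      using that by (simp add: x mult_left_mono)
    finally show ?thesis
      using that by (simp add: x scale_in algebra_simps)
  qed
qed

text \<open>The sign \<open>\<sigma>\<close> treats the cones \<open>A\<close> (with 1) and
  \<open>B\<close> (with -1) together. Over \<open>a = 0\<close> only the zero vector occurs,
  because coordinates of equal sign cancel only if they vanish.\<close>

lemma convex_cone_positive_slope: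
  fixes \<sigma> \<delta> :: real
  assumes "\<sigma> \<noteq> 0"
  shows "convex_cone {((w, a), c). w \<in> X \<and> 0 \<le> \<sigma> * a \<and> \<delta> * (\<sigma> * a) \<le> c \<and> (a = 0 \<longrightarrow> w = 0 \<and> c = 0)}"
  (is "convex_cone ?S")
  unfolding convex_cone_iff
proof (intro conjI ballI allI impI)
  show "0 \<in> ?S" by (simp add: zero_prod_def zero_in)
  show "x + y \<in> ?S" if "x \<in> ?S" "y \<in> ?S" for x y
  proof -
    obtain w a c w' a' c' where xy: "x = ((w, a), c)" "y = ((w', a'), c')"
      by (metis prod.exhaust)
    have "a = 0 \<and> a' = 0" if "a + a' = 0"
    proof -
      have "\<sigma> * a + \<sigma> * a' = 0" using that by (simp flip: distrib_left)
      moreover have "0 \<le> \<sigma> * a" "0 \<le> \<sigma> * a'" using \<open>x \<in> ?S\<close> \<open>y \<in> ?S\<close> xy by simp_all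
      ultimately have "\<sigma> * a = 0 \<and> \<sigma> * a' = 0" by linarith
      then show ?thesis using assms by simp
    qed
    then show ?thesis
      using that by (auto simp: xy add_in distrib_left)
  qed
  show "k *\<^sub>R x \<in> ?S" if "x \<in> ?S" "0 \<le> k" for x k
  proof -
    obtain w a c where x: "x = ((w, a), c)"
      by (metis prod.exhaust)
    have "0 \<le> k * (\<sigma> * a)" "k * (\<delta> * (\<sigma> * a)) \<le> k * c"
      using that by (simp_all add: x mult_left_mono)
    then show ?thesis
      using that(1) by (auto simp: x scale_in algebra_simps)
  qed
qed

text \<open>The norm \<open>P\<close> is the largest one that agrees with \<open>p\<close> on \<open>X\<close> and satisfies the bounds prescribed at
  the points \<open>(- y, 1)\<close> and \<open>(y, - 1)\<close>: the gauge of the sum \<open>W\<close> of the epigraph \<open>E\<close> of \<open>p\<close> and the cones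
  \<open>A\<close> and \<open>B\<close> generated by these bounds. It agrees with \<open>p\<close> because \<open>p (y' - y) \<le> r + s'\<close> extends
  bilinearly from the generators of \<open>A\<close> and \<open>B\<close> to the cones.\<close>

lemma one_point_extension:
  assumes F: "\<And>y r s. (y, r, s) \<in> F \<Longrightarrow> y \<in> X \<and> \<delta> \<le> r \<and> \<delta> \<le> s"
    and le: "\<And>y r s y' r' s'. (y, r, s) \<in> F \<Longrightarrow> (y', r', s') \<in> F \<Longrightarrow> p (y' - y) \<le> r + s'"
    and "F \<noteq> {}" and \<delta>: "0 < \<delta>"
  obtains P where "asymmetric_normed_space (X \<times> UNIV) P"
    "\<And>y. y \<in> X \<Longrightarrow> P (y, 0) = p y"
    "\<And>y t. y \<in> X \<Longrightarrow> \<delta> * \<bar>t\<bar> \<le> P (y, t)"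
    "\<And>y r s. (y, r, s) \<in> F \<Longrightarrow> P (- y, 1) \<le> r \<and> P (y, - 1) \<le> s"
proof -
  define E where "E = {((u, t::real), c). u \<in> X \<and> t = 0 \<and> p u \<le> c}"
  define A where "A = convex_cone hull ((\<lambda>(y, r, s). ((- y, 1::real), r)) ` F)"
  define B where "B = convex_cone hull ((\<lambda>(y, r, s). ((y, - 1::real), s)) ` F)"
  have cones: "convex_cone E" "convex_cone A" "convex_cone B"
    unfolding E_def A_def B_def by (rule convex_cone_epigraph convex_cone_convex_cone_hull)+
  have A: "w \<in> X \<and> 0 \<le> a \<and> \<delta> * a \<le> c \<and> (a = 0 \<longrightarrow> w = 0 \<and> c = 0)" if "((w, a), c) \<in> A" for w a c
  proof -
    have "A \<subseteq> {((w, a), c). w \<in> X \<and> 0 \<le> 1 * a \<and> \<delta> * (1 * a) \<le> c \<and> (a = 0 \<longrightarrow> w = 0 \<and> c = 0)}"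
      unfolding A_def
      by (rule hull_minimal, use F neg_in in force, rule convex_cone_positive_slope, simp)
    then show ?thesis using that by auto
  qed
  have B: "v \<in> X \<and> b \<le> 0 \<and> \<delta> * - b \<le> d \<and> (b = 0 \<longrightarrow> v = 0 \<and> d = 0)" if "((v, b), d) \<in> B" for v b d
  proof -
    have "B \<subseteq> {((w, a), c). w \<in> X \<and> 0 \<le> (-1) * a \<and> \<delta> * ((-1) * a) \<le> c \<and> (a = 0 \<longrightarrow> w = 0 \<and> c = 0)}"
      unfolding B_def
      by (rule hull_minimal, use F in force, rule convex_cone_positive_slope, simp)
    then show ?thesis using that by auto
  qed
  have AB: "p (a *\<^sub>R v - b *\<^sub>R w) \<le> a * d - b * c" if "((w, a), c) \<in> A" "((v, b), d) \<in> B" for w a c v b d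
  proof -
    \<comment> \<open>First a generator \<open>((y, - 1), s)\<close> of \<open>B\<close> is fixed
      while the other argument runs through \<open>A\<close>; then an element of \<open>A\<close> is
      fixed while the other argument runs through \<open>B\<close>.\<close>
    have generator: "p (a *\<^sub>R y + w) \<le> a * s + c" if F': "(y, r, s) \<in> F" and wA: "((w, a), c) \<in> A" for y r s w a c
    proof -
      have "A \<subseteq> {((v, b), d). v \<in> X \<and> p (1 *\<^sub>R v - b *\<^sub>R (- y)) \<le> 1 * d - b * (- s)}"
        unfolding A_def
        by (rule hull_minimal, use F F' le neg_in in force, rule convex_cone_pairing)
          (use F F' neg_in in blast)
      then show ?thesis using wA by (auto simp: algebra_simps)
    qed
    have "w \<in> X" using A that(1) by blast
    then have "B \<subseteq> {((v, b), d). v \<in> X \<and> p (a *\<^sub>R v - b *\<^sub>R w) \<le> a * d - b * c}"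
      unfolding B_def
      by (intro hull_minimal convex_cone_pairing) (use F generator[OF _ that(1)] in force)
    then show ?thesis using that(2) by auto
  qed
  define W where "W = (\<Union>e\<in>E. \<Union>f\<in>(\<Union>f\<in>A. \<Union>g\<in>B. {f + g}). {e + f})"
  have W_intro: "e + (f + g) \<in> W" if "e \<in> E" "f \<in> A" "g \<in> B" for e f g
    unfolding W_def using that by blast
  have W_elim: "\<exists>u w a c v b d. u \<in> X \<and> p u + c + d \<le> k \<and> ((w, a), c) \<in> A \<and> ((v, b), d) \<in> B \<and>
      y = u + (w + v) \<and> t = a + b" if "((y, t), k) \<in> W" for y t k
  proof -
    obtain e f g where efg: "e \<in> E" "f \<in> A" "g \<in> B" "((y, t), k) = e + (f + g)"
      using \<open>((y, t), k) \<in> W\<close> unfolding W_def by blast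
    obtain u c0 where "e = ((u, 0), c0)" "u \<in> X" "p u \<le> c0"
      using efg(1) unfolding E_def by blast
    moreover obtain w a c v b d where "f = ((w, a), c)" "g = ((v, b), d)"
      by (metis prod.exhaust)
    ultimately show ?thesis
      using efg by (intro exI[of _ u] exI[of _ w] exI[of _ a] exI[of _ c] exI[of _ v] exI[of _ b] exI[of _ d]) simp
  qed
  \<comment> \<open>Since \<open>b \<le> 0 \<le> a\<close>, the absolute value of
    \<open>t = a + b\<close> is at most \<open>a - b\<close>, and the parts from \<open>A\<close>
    and \<open>B\<close> cost at least \<open>\<delta> * a\<close> and
    \<open>\<delta> * - b\<close>.\<close>
  have W_slope: "y \<in> X \<and> \<delta> * \<bar>t\<bar> \<le> k" if W: "((y, t), k) \<in> W" for y t k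
  proof -
    obtain u w a c v b d where *: "u \<in> X" "p u + c + d \<le> k" "((w, a), c) \<in> A" "((v, b), d) \<in> B"
      "y = u + (w + v)" "t = a + b"
      using W_elim[OF W] by blast
    have "\<delta> * \<bar>t\<bar> \<le> \<delta> * (a - b)"
      using A[OF *(3)] B[OF *(4)] *(6) \<delta> by (intro mult_left_mono) auto
    then show ?thesis
      using * A[OF *(3)] B[OF *(4)] nonneg[of u] by (auto simp: algebra_simps add_in)
  qed
  \<comment> \<open>Here \<open>b = - a\<close>, so the pairing inequality reads
    \<open>p (a *\<^sub>R (w + v)) \<le> a * (c + d)\<close> and can be divided by \<open>a\<close>
    unless \<open>a = 0\<close>, when both parts are zero.\<close>
  have W_zero: "p y \<le> k" if W: "((y, 0), k) \<in> W" for y k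
  proof -
    obtain u w a c v b d where *: "u \<in> X" "p u + c + d \<le> k" "((w, a), c) \<in> A" "((v, b), d) \<in> B"
      "y = u + (w + v)" "0 = a + b"
      using W_elim[OF W] by blast
    have b: "b = - a" using *(6) by simp
    have wv: "w \<in> X" "v \<in> X" "0 \<le> a" using A[OF *(3)] B[OF *(4)] by auto
    have "p (w + v) \<le> c + d"
    proof (cases "a = 0")
      case True
      then show ?thesis using A[OF *(3)] B[OF *(4)] b by simp
    next
      case False
      have "p (a *\<^sub>R (w + v)) \<le> a * (c + d)"
        using AB[OF *(3,4)] by (simp add: b algebra_simps)
      moreover have "p (a *\<^sub>R (w + v)) = a * p (w + v)"
        using wv by (intro pos_homogeneous add_in)
      ultimately show ?thesis using False wv(3) by simp
    qed
    then have "p y \<le> p u + (c + d)"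
      using * wv by (intro triangle_le[OF *(5)]) (auto intro: add_in)
    then show ?thesis using *(2) by simp
  qed
  have W_total: "\<exists>k. ((y, t), k) \<in> W" if y: "y \<in> X" for y t
  proof -
    obtain y0 r0 s0 where F0: "(y0, r0, s0) \<in> F" using \<open>F \<noteq> {}\<close> by (metis ex_in_conv prod.exhaust)
    \<comment> \<open>Then \<open>(y, t)\<close> is \<open>(u, 0)\<close> plus \<open>t\<close>
      times the generator \<open>(- y0, 1)\<close>, or plus \<open>- t\<close> times
      \<open>(y0, - 1)\<close> when \<open>t\<close> is negative.\<close>
    define u where "u = y + t *\<^sub>R y0"
    have "u \<in> X" using F[OF F0] y by (simp add: u_def carrier)
    then have u: "((u, 0), p u) \<in> E" by (simp add: E_def)
    show ?thesis
    proof (cases "0 \<le> t")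
      case True
      have "((- y0, 1), r0) \<in> A" unfolding A_def using F0 by (force intro: hull_inc)
      then have "t *\<^sub>R ((- y0, 1), r0) \<in> A" by (rule convex_cone_scaleR[OF cones(2) True])
      from W_intro[OF u this convex_cone_contains_0[OF cones(3)]]
      show ?thesis by (auto simp: u_def)
    next
      case False
      have "((y0, -1), s0) \<in> B" unfolding B_def using F0 by (force intro: hull_inc)
      then have "(- t) *\<^sub>R ((y0, -1), s0) \<in> B"
        using False by (intro convex_cone_scaleR[OF cones(3)]) auto
      from W_intro[OF u convex_cone_contains_0[OF cones(2)] this]
      show ?thesis by (auto simp: u_def)
    qed
  qed
  interpret W: nonneg_cone W
  proof
    show "convex_cone W" unfolding W_def by (intro convex_cone_sums cones)
    show "0 \<le> k" if "(x, k) \<in> W" for x k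
      using W_slope[of "fst x" "snd x" k] that \<delta> by (force intro: order_trans[of 0 "\<delta> * \<bar>snd x\<bar>"])
  qed
  let ?P = "gauge_of W"
  have slope: "\<delta> * \<bar>t\<bar> \<le> ?P (y, t)" if "y \<in> X" for y t
    using W_total[OF that] W_slope by (blast intro: W.le_gauge_of)
  have extends: "?P (y, 0) = p y" if "y \<in> X" for y
  proof (rule antisym)
    have "((y, 0), p y) \<in> E" using that by (simp add: E_def)
    from W_intro[OF this convex_cone_contains_0[OF cones(2)] convex_cone_contains_0[OF cones(3)]]
    show "?P (y, 0) \<le> p y" by (simp add: W.gauge_of_le)
    show "p y \<le> ?P (y, 0)"
      using W_total[OF that] W_zero by (blast intro: W.le_gauge_of)
  qed
  show ?thesis
  proof
    show "asymmetric_normed_space (X \<times> UNIV) ?P"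
    proof
      show "subspace (X \<times> (UNIV :: real set))"
        using subspace by (rule subspace_Times) simp
    next
      fix x :: "'a \<times> real" assume x: "x \<in> X \<times> UNIV"
      then show nonneg: "0 \<le> ?P x"
        using slope[of "fst x" "snd x"] \<delta> by (force intro: order_trans[of 0 "\<delta> * \<bar>snd x\<bar>"])
      show "?P x = 0 \<and> ?P (- x) = 0 \<longleftrightarrow> x = 0"
      proof
        assume P0: "?P x = 0 \<and> ?P (- x) = 0"
        obtain y t where yt: "x = (y, t)" "y \<in> X" using x by auto
        have "\<delta> * \<bar>t\<bar> \<le> 0" using slope[OF yt(2), of t] P0 yt(1) by simp
        then have "t = 0" using \<delta> by (simp add: mult_le_0_iff)
        then have "p y = 0 \<and> p (- y) = 0"
          using P0 extends[OF yt(2)] extends[OF neg_in[OF yt(2)]] by (simp add: yt(1))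
        then show "x = 0"
          using separating[OF yt(2)] \<open>t = 0\<close> by (simp add: yt(1) zero_prod_def)
      qed (simp add: W.gauge_of_0)
      obtain k where k: "(x, k) \<in> W" using W_total[of "fst x" "snd x"] x by auto
      show "?P (\<alpha> *\<^sub>R x) = \<alpha> * ?P x" if "0 \<le> \<alpha>" for \<alpha>
        using W.gauge_of_scaleR[OF k that] .
      show "?P (x + y) \<le> ?P x + ?P y" if y: "y \<in> X \<times> UNIV" for y
      proof -
        obtain l where "(y, l) \<in> W" using W_total[of "fst y" "snd y"] y by auto
        then show ?thesis using W.gauge_of_add[OF k] by blast
      qed
    qed
    show "?P (y, 0) = p y" if "y \<in> X" for y using extends[OF that] .
    show "\<delta> * \<bar>t\<bar> \<le> ?P (y, t)" if "y \<in> X" for y t using slope[OF that] .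
    show "?P (- y, 1) \<le> r \<and> ?P (y, - 1) \<le> s" if F': "(y, r, s) \<in> F" for y r s
    proof (intro conjI)
      have "((- y, 1), r) \<in> A" unfolding A_def using F' by (force intro: hull_inc)
      from W_intro[OF convex_cone_contains_0[OF cones(1)] this convex_cone_contains_0[OF cones(3)]]
      show "?P (- y, 1) \<le> r" by (simp add: W.gauge_of_le)
      have "((y, -1), s) \<in> B" unfolding B_def using F' by (force intro: hull_inc)
      from W_intro[OF convex_cone_contains_0[OF cones(1)] convex_cone_contains_0[OF cones(2)] this]
      show "?P (y, -1) \<le> s" by (simp add: W.gauge_of_le)
    qed
  qed
qed

text \<open>Points of \<open>X \<times> {0}\<close> have distance at least
  \<open>\<delta> * \<bar>t\<bar>\<close> from \<open>(y, t)\<close>, so the ball of that radius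
  avoids them.\<close>

lemma closedin_hyperplane:
  assumes "\<And>y t. y \<in> X \<Longrightarrow> \<delta> * \<bar>t\<bar> \<le> P (y, t)" and "0 < \<delta>"
  shows "closedin (asym_topology (X \<times> UNIV) P) (X \<times> {0::real})"
proof -
  have "openin (asym_topology (X \<times> UNIV) P) (X \<times> UNIV - X \<times> {0})"
    unfolding openin_asym_topology
  proof (intro conjI ballI)
    fix x assume "x \<in> X \<times> UNIV - X \<times> {0::real}"
    then obtain y t where x: "x = (y, t)" "y \<in> X" "t \<noteq> 0" by auto
    have "asym_ball (X \<times> UNIV) P x (\<delta> * \<bar>t\<bar>) \<subseteq> X \<times> UNIV - X \<times> {0}"
      using assms(1)[OF diff_in[OF _ x(2)], of _ "- t"]
      by (fastforce simp: asym_ball_def x not_less)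
    then show "\<exists>r>0. asym_ball (X \<times> UNIV) P x r \<subseteq> X \<times> UNIV - X \<times> {0}"
      using x(3) \<open>0 < \<delta>\<close> by (intro exI[of _ "\<delta> * \<bar>t\<bar>"]) auto
  qed blast
  then show ?thesis
    by (auto simp: closedin_def topspace_asym_topology)
qed

text \<open>The identity of \<open>X\<close> becomes \<open>fst\<close> on
  \<open>X \<times> {0}\<close>. For an extension \<open>S\<close> of norm at most 1, the point
  \<open>S (0, 1)\<close> inherits the bounds of \<open>P\<close> at \<open>(- y, 1)\<close> and
  \<open>(y, - 1)\<close>, which are the required ball conditions.\<close>

lemma extension_imp_ball_property:
  assumes ext: "norm_preserving_extension_property TYPE('a \<times> real) X p" and \<delta>: "0 < \<delta>"
  shows "ball_property \<delta> X p"
  unfolding ball_property_def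
proof (intro allI impI)
  fix F :: "('a \<times> real \<times> real) set"
  assume "\<forall>(y, r, s)\<in>F. y \<in> X \<and> \<delta> \<le> r \<and> \<delta> \<le> s"
    and "\<forall>(y, r, s)\<in>F. \<forall>(y', r', s')\<in>F. p (y' - y) \<le> r + s'"
  then have F: "\<And>y r s. (y, r, s) \<in> F \<Longrightarrow> y \<in> X \<and> \<delta> \<le> r \<and> \<delta> \<le> s"
    and le: "\<And>y r s y' r' s'. (y, r, s) \<in> F \<Longrightarrow> (y', r', s') \<in> F \<Longrightarrow> p (y' - y) \<le> r + s'"
    by fast+
  show "\<exists>x\<in>X. \<forall>(y, r, s)\<in>F. p (x - y) \<le> r \<and> p (y - x) \<le> s"
  proof (cases "F = {}")
    case True
    then show ?thesis using zero_in by auto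
  next
    case False
    obtain P where P: "asymmetric_normed_space (X \<times> UNIV) P"
      "\<And>y. y \<in> X \<Longrightarrow> P (y, 0) = p y"
      "\<And>y t. y \<in> X \<Longrightarrow> \<delta> * \<bar>t\<bar> \<le> P (y, t)"
      "\<And>y r s. (y, r, s) \<in> F \<Longrightarrow> P (- y, 1) \<le> r \<and> P (y, - 1) \<le> s"
      by (rule one_point_extension[OF _ _ False \<delta>]) (use F le in blast)+
    let ?Z = "X \<times> {0::real}"
    have Z: "subspace ?Z" "?Z \<subseteq> X \<times> UNIV"
      using subspace by (auto intro: subspace_Times)
    have closed: "closedin (asym_topology (X \<times> UNIV) P) ?Z"
      "closedin (asym_topology (X \<times> UNIV) (conjugate P)) ?Z"
    proof -
      show "closedin (asym_topology (X \<times> UNIV) P) ?Z"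
        using P(3) \<delta> by (rule closedin_hyperplane)
      show "closedin (asym_topology (X \<times> UNIV) (conjugate P)) ?Z"
      proof (rule closedin_hyperplane[OF _ \<delta>])
        show "\<delta> * \<bar>t\<bar> \<le> conjugate P (y, t)" if "y \<in> X" for y t
          using P(3)[OF neg_in[OF that], of "- t"] by (simp add: conjugate_def)
      qed
    qed
    have self: "asymmetric_normed_space X p" by unfold_locales
    have Zspace: "asymmetric_normed_space ?Z P"
      using P(1) Z by (rule asymmetric_normed_space.restrict)
    have fst_bound: "p (fst z) \<le> 1 * P z" if "z \<in> ?Z" for z
      using that P(2) by auto
    have T: "continuous_linear_operator ?Z P X p fst"
      by (rule bounded_imp_continuous_linear_operator[OF Zspace self, where \<beta> = 1])
        (use fst_bound in \<open>auto simp: linear_on_def\<close>)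
    obtain S where S: "continuous_linear_operator (X \<times> UNIV) P X p S" "\<And>z. z \<in> ?Z \<Longrightarrow> S z = fst z"
      "asym_opnorm (X \<times> UNIV) P p S = asym_opnorm ?Z P p fst"
      using ext[unfolded norm_preserving_extension_property_def, rule_format, OF P(1) Z closed T]
      by blast
    \<comment> \<open>Equality would fail for \<open>X = {0}\<close>, where the norm is 0.\<close>
    have S_norm: "asym_opnorm (X \<times> UNIV) P p S \<le> 1"
      unfolding S(3) using asym_opnorm_le[OF Zspace self T, of 1] fst_bound by simp
    have S_bound: "p (S x) \<le> P x" if "x \<in> X \<times> UNIV" for x
    proof -
      have "p (S x) \<le> asym_opnorm (X \<times> UNIV) P p S * P x"
        by (rule asym_opnorm_bound[OF P(1) self S(1) that])
      also have "\<dots> \<le> 1 * P x"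
        using S_norm asymmetric_normed_space.nonneg[OF P(1) that] by (rule mult_right_mono)
      finally show ?thesis by simp
    qed
    have S_linear: "S (x + y) = S x + S y" "S (c *\<^sub>R x) = c *\<^sub>R S x"
      if "x \<in> X \<times> UNIV" "y \<in> X \<times> UNIV" for x y c
      using S(1) that by (auto simp: continuous_linear_operator_def linear_on_def)
    define z where "z = S (0, 1)"
    have "z \<in> X"
      using S(1) zero_in by (auto simp: z_def continuous_linear_operator_def)
    have "S (y, t) = y + t *\<^sub>R z" if "y \<in> X" for y t
      using S_linear(1)[of "(y, 0)" "(0, t)"] S_linear(2)[of "(0, 1)" "(0, 1)" t] S(2)[of "(y, 0)"]
        that zero_in by (simp add: z_def)
    then have "p (z - y) \<le> r \<and> p (y - z) \<le> s" if "(y, r, s) \<in> F" for y r s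
      using S_bound[of "(- y, 1)"] S_bound[of "(y, - 1)"] P(4)[OF that] F[OF that] neg_in[of y]
      by fastforce
    then show ?thesis using \<open>z \<in> X\<close> by blast
  qed
qed

end

text \<open>A type cannot be quantified inside the statement. The single ambient type
  \<open>'b \<times> real\<close> suffices to recover the intersection property, as it contains the
  one-point extensions of \<open>Y\<close>; the second conjunct gives extensions in an arbitrary
  ambient type.\<close>

theorem theorem3p2:
  fixes Y :: "'b::real_vector set" and q :: "'b \<Rightarrow> real"
  assumes "asymmetric_normed_space Y q"
  shows "(mixed_BIP Y q \<longleftrightarrow> norm_preserving_extension_property TYPE('b \<times> real) Y q) \<and>
         (mixed_BIP Y q \<longrightarrow> norm_preserving_extension_property TYPE('a::real_vector) Y q)"
proof -
  interpret asymmetric_normed_space Y q by fact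
  have *: "ball_property 0 Y q" if "mixed_BIP Y q"
    using that by (intro ball_property_zero mixed_BIP_imp_ball_property)
  have "norm_preserving_extension_property TYPE('b \<times> real) Y q" if "mixed_BIP Y q"
    using assms *[OF that] by (rule ball_property_imp_extension)
  moreover have "norm_preserving_extension_property TYPE('a) Y q" if "mixed_BIP Y q"
    using assms *[OF that] by (rule ball_property_imp_extension)
  moreover have "mixed_BIP Y q" if "norm_preserving_extension_property TYPE('b \<times> real) Y q"
    using that by (intro ball_property_imp_mixed_BIP ball_property_zero extension_imp_ball_property)
  ultimately show ?thesis
    by blast
qed

end
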